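(* Let $A, C \in \mathbb{F}_3[T]$ be nonzero polynomials with $\deg A \geq \deg C$ and such that $C$ divides $A$. Let $\beta \in \mathbb{F}_3((T^{-1}))$ be the irrational solution of $C\beta^{4} - A\beta + 1 = 0$ satisfying $|\beta| < 1$. Then the continued fraction expansion of $\beta$ is $\beta = [b_0, b_1, \ldots, b_n, \ldots]$ with $b_0 = 0$, $b_1 = A$, and for all $n \geq 2$, $$b_n = \begin{cases} -C\, b_{n-1}^{3} & \text{if } n \text{ is odd},\\ b_{n-1}^{3}/(-C) & \text{if } n \text{ is even}.\end{cases}$$ Furthermore, $\nu(\beta) = 4$.
   Context: $\mathbb{F}_3$ is the field with three elements, $\mathbb{F}_3((T^{-1}))$ the field of formal power series in $1/T$, with the absolute value $|x| = |T|^{\deg x}$ extending $|P/Q| = |T|^{\deg P - \deg Q}$ on $\mathbb{F}_3(T)$, where $|T|>1$ is a fixed real number. Every irrational $x$ has a continued fraction expansion $x=[a_0,a_1,a_2,\ldots]$ with $a_i \in \mathbb{F}_3[T]$ and $\deg a_i > 0$ for $i \ge 1$. The irrationality measure (approximation exponent) of an irrational $x$ is $\nu(x) = -\limsup_{|Q|\to\infty} \log|x - P/Q| / \log|Q|$, where $P,Q \in \mathbb{F}_3[T]$.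
   Formalization: The irrationality measure is taken as limsup of −log|x−P/Q|/log|Q|, with the minus sign inside the limsup; as printed, −limsup over all P, Q is −∞ for every irrational x (take Q = T^n, P = T^(n^2)). *)

theory Defs
  imports
    "HOL-Computational_Algebra.Computational_Algebra"
    "HOL-Library.Extended_Real"
    "HOL-Library.Liminf_Limsup"
    "HOL-Library.Cardinality"
begin

text \<open>
  The type \<open>'a fls\<close> models the field of formal power series in $1/T$: the library variable
  \<open>fls_X\<close> plays the role of $1/T$ and \<open>fls_X_inv\<close> that of $T$. In particular the degree in $T$ of
  a nonzero series is the negated \<open>fls_subdegree\<close>, and the library topology on \<open>'a fls\<close> is the
  one induced by the absolute value \<open>fls_abs t\<close> below, for every real $t = |T| > 1$.
\<close>

text \<open>The embedding of $K[T]$ is evaluation at $T$.\<close>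

definition poly_to_fls :: "'a::field poly \<Rightarrow> 'a fls" where
  "poly_to_fls p = poly (map_poly fls_const p) fls_X_inv"

text \<open>The parameter \<open>t\<close> is the fixed real number $|T|$.\<close>

definition fls_abs :: "real \<Rightarrow> 'a::zero fls \<Rightarrow> real" where
  "fls_abs t x = (if x = 0 then 0 else t powi (- fls_subdegree x))"

definition irrational_fls :: "'a::field fls \<Rightarrow> bool" where
  "irrational_fls x \<longleftrightarrow> (\<forall>P Q. Q \<noteq> 0 \<longrightarrow> x \<noteq> poly_to_fls P / poly_to_fls Q)"

text \<open>\<open>cfrac_convergent b n\<close> is the finite continued fraction $[b_0, \ldots, b_n]$.\<close>

fun cfrac_convergent :: "(nat \<Rightarrow> 'a::field poly) \<Rightarrow> nat \<Rightarrow> 'a fls" where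
  "cfrac_convergent b 0 = poly_to_fls (b 0)"
| "cfrac_convergent b (Suc n) =
     poly_to_fls (b 0) + 1 / cfrac_convergent (\<lambda>i. b (Suc i)) n"

definition cfrac_expansion :: "'a::field fls \<Rightarrow> (nat \<Rightarrow> 'a poly) \<Rightarrow> bool" where
  "cfrac_expansion x b \<longleftrightarrow>
     (\<forall>i\<ge>1. degree (b i) > 0) \<and> (\<lambda>n. cfrac_convergent b n) \<longlonglongrightarrow> x"

text \<open>
  The limit superior is taken over all pairs of polynomials $(P, Q)$ as $|Q| \to \infty$. The minus
  sign belongs inside: the measure is the limit superior of $- \log |x - P/Q| / \log |Q|$.
  Placing it outside would make the quantity \<open>-\<infinity>\<close> for every irrational $x$, since $P$ is
  arbitrary. The logarithm of $|x - P/Q|$ is only meaningful for irrational $x$.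
\<close>

definition irrationality_measure :: "real \<Rightarrow> 'a::field fls \<Rightarrow> ereal" where
  "irrationality_measure t x =
     Limsup (filtercomap (\<lambda>(P, Q). fls_abs t (poly_to_fls Q)) at_top)
       (\<lambda>(P, Q). ereal (- (ln (fls_abs t (x - poly_to_fls P / poly_to_fls Q))
                          / ln (fls_abs t (poly_to_fls Q)))))"

end

theory Submission
  imports Defs
begin

text \<open>
  Write the equation as \<open>1 / \<beta> = A - C * \<beta> ^ 3\<close>. As cubing is additive in characteristic three,
  each complete quotient is, up to the factor \<open>- C\<close> or its inverse, the cube of the preceding one,
  and the partial quotients obey the same recursion.

  The exponent does not need the continued fraction. Put
  \<open>F p q = C * p ^ 4 - A * p * q ^ 3 + q ^ 4\<close>. Additivity of the cube gives
  \<open>|F p q| = |A| * |q| ^ 4 * |p / q - \<beta>|\<close> whenever \<open>|p / q - \<beta>| < 1\<close>. A nonzero polynomial has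
  absolute value at least \<open>1\<close>, so the exponent is at most \<open>4\<close>; it is attained because
  \<open>F p q = 1\<close> has solutions with \<open>q\<close> of arbitrarily large degree.
\<close>

section \<open>The embedding of polynomials\<close>

lemma poly_to_fls_0 [simp]: "poly_to_fls 0 = 0"
  by (simp add: poly_to_fls_def)

lemma poly_to_fls_pCons [simp]:
  "poly_to_fls (pCons a p) = fls_const a + fls_X_inv * poly_to_fls p"
  by (simp add: poly_to_fls_def map_poly_pCons)

lemma poly_to_fls_1 [simp]: "poly_to_fls 1 = 1"
  by (simp add: one_pCons)

lemma poly_to_fls_add [simp]: "poly_to_fls (p + q) = poly_to_fls p + poly_to_fls q"
  by (induction p q rule: poly_induct2) (auto simp: algebra_simps fls_plus_const)

lemma poly_to_fls_uminus [simp]: "poly_to_fls (- p) = - poly_to_fls p"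
  by (metis add_eq_0_iff poly_to_fls_0 poly_to_fls_add add.right_inverse)

lemma poly_to_fls_diff [simp]: "poly_to_fls (p - q) = poly_to_fls p - poly_to_fls q"
  using poly_to_fls_add[of p "- q"] by simp

lemma poly_to_fls_smult [simp]: "poly_to_fls (smult a p) = fls_const a * poly_to_fls p"
  by (induction p) (auto simp: algebra_simps)

lemma poly_to_fls_mult [simp]: "poly_to_fls (p * q) = poly_to_fls p * poly_to_fls q"
  by (induction p) (auto simp: algebra_simps)

lemma poly_to_fls_power [simp]: "poly_to_fls (p ^ n) = poly_to_fls p ^ n"
  by (induction n) auto

section \<open>The absolute value\<close>

lemma fls_abs_0 [simp]: "fls_abs t 0 = 0"
  by (simp add: fls_abs_def)

text \<open>The library metric is the case \<open>t = 2\<close>, which is why convergence is handled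
  with \<open>fls_abs 2\<close>.\<close>

lemma dist_fls_eq_fls_abs: "dist x y = fls_abs 2 (x - y)" for x y :: "'a::group_add fls"
  by (auto simp: dist_fls_def fls_abs_def power_int_def power_one_over inverse_eq_divide)

context
  fixes t :: real
  assumes t: "t > 1"
begin

lemma fls_abs_pos_iff [simp]: "fls_abs t x > 0 \<longleftrightarrow> x \<noteq> 0"
  using t by (simp add: fls_abs_def)

lemma fls_abs_nonneg [simp]: "fls_abs t x \<ge> 0"
  using t by (simp add: fls_abs_def)

lemma fls_abs_eq_0_iff [simp]: "fls_abs t x = 0 \<longleftrightarrow> x = 0"
  using t by (simp add: fls_abs_def)

lemma fls_abs_1 [simp]: "fls_abs t (1 :: 'a::zero_neq_one fls) = 1"
  by (simp add: fls_abs_def)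

lemma fls_abs_mult [simp]: "fls_abs t (x * y) = fls_abs t x * fls_abs t y"
  for x y :: "'a::field fls"
  using t by (simp add: fls_abs_def power_int_diff power_int_minus field_simps power_int_add)

lemma fls_abs_inverse [simp]: "fls_abs t (inverse x) = inverse (fls_abs t x)"
  for x :: "'a::field fls"
  using t by (simp add: fls_abs_def power_int_minus)

lemma fls_abs_divide [simp]: "fls_abs t (x / y) = fls_abs t x / fls_abs t y"
  for x y :: "'a::field fls"
  by (simp add: divide_inverse)

lemma fls_abs_power [simp]: "fls_abs t (x ^ n) = fls_abs t x ^ n" for x :: "'a::field fls"
  by (induction n) auto

lemma fls_abs_uminus [simp]: "fls_abs t (- x) = fls_abs t x" for x :: "'a::group_add fls"
  by (simp add: fls_abs_def)

text \<open>The right-hand side does not involve \<open>t\<close>, so smallness can be moved from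
  one value of \<open>t\<close> to another.\<close>

lemma fls_abs_less_1_iff: "fls_abs t x < 1 \<longleftrightarrow> x = 0 \<or> fls_subdegree x > 0"
  using t one_less_power_int[of t "fls_subdegree x"] one_le_power_int[of t "- fls_subdegree x"]
  by (auto simp: fls_abs_def power_int_minus inverse_less_1_iff not_less[symmetric])

lemma fls_abs_minus_commute: "fls_abs t (x - y) = fls_abs t (y - x)" for x y :: "'a::group_add fls"
  by (metis fls_abs_uminus minus_diff_eq)

text \<open>The ultrametric inequality; the strict common bound \<open>r\<close> lets it be chained
  without maxima.\<close>

lemma fls_abs_add_less:
  fixes x y :: "'a::group_add fls"
  assumes "fls_abs t x < r" "fls_abs t y < r"
  shows "fls_abs t (x + y) < r"
proof (cases "x = 0 \<or> y = 0 \<or> x + y = 0")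
  case True
  moreover have "0 < r"
    using assms(1) fls_abs_nonneg[of x] by linarith
  ultimately show ?thesis
    using assms by auto
next
  case False
  then have "min (fls_subdegree x) (fls_subdegree y) \<le> fls_subdegree (x + y)"
    by (intro fls_plus_subdegree) auto
  then have "fls_subdegree x \<le> fls_subdegree (x + y) \<or> fls_subdegree y \<le> fls_subdegree (x + y)"
    by linarith
  then have "fls_abs t (x + y) \<le> fls_abs t x \<or> fls_abs t (x + y) \<le> fls_abs t y"
    using False t by (auto simp: fls_abs_def intro!: power_int_increasing)
  then show ?thesis
    using assms by auto
qed

lemma fls_abs_diff_less:
  fixes x y :: "'a::group_add fls"
  assumes "fls_abs t x < r" "fls_abs t y < r"
  shows "fls_abs t (x - y) < r"
  using fls_abs_add_less[of x r "- y"] assms by simp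

text \<open>The dominant summand decides the size: were \<open>|x + y| < |x|\<close>, then
  \<open>x = (x + y) - y\<close> would be smaller than itself.\<close>

lemma fls_abs_add_eq:
  fixes x y :: "'a::group_add fls"
  assumes "fls_abs t y < fls_abs t x"
  shows "fls_abs t (x + y) = fls_abs t x"
proof -
  have "fls_abs t (x + y) \<ge> fls_abs t x"
    using fls_abs_diff_less[of "x + y" "fls_abs t x" y] assms by fastforce
  moreover have "fls_abs t (x + y) \<le> fls_abs t x"
  \<comment> \<open>The strict ultrametric inequality gives the weak bound only after adding a slack
    \<open>e\<close>.\<close>
  proof (rule field_le_epsilon)
    fix e :: real assume "e > 0"
    then show "fls_abs t (x + y) \<le> fls_abs t x + e"
      using fls_abs_add_less[of x "fls_abs t x + e" y] assms by simp
  qed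
  ultimately show ?thesis by simp
qed

lemma fls_abs_diff_eq:
  fixes x y :: "'a::group_add fls"
  assumes "fls_abs t y < fls_abs t x"
  shows "fls_abs t (x - y) = fls_abs t x"
  using fls_abs_add_eq[of "- y" x] assms by simp

text \<open>Multiplying by \<open>fls_X_inv\<close> scales by \<open>t\<close>, and the added
  constant, of size at most 1, is dominated.\<close>

lemma fls_abs_poly_to_fls:
  assumes "p \<noteq> 0"
  shows "fls_abs t (poly_to_fls p) = t ^ degree p"
  using assms
proof (induction p)
  case (pCons a p)
  show ?case
  proof (cases "p = 0")
    case True
    with pCons show ?thesis by (simp add: fls_abs_def)
  next
    case False
    have X: "fls_abs t (fls_X_inv :: 'a fls) = t"
      using t by (simp add: fls_abs_def)
    have "fls_abs t (fls_const a) \<le> 1"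
      by (simp add: fls_abs_def)
    also have "1 < t ^ Suc (degree p)"
      using t by (intro one_less_power) auto
    also have "\<dots> = fls_abs t (fls_X_inv * poly_to_fls p)"
      using pCons.IH[OF False] X by simp
    finally have "fls_abs t (fls_X_inv * poly_to_fls p + fls_const a)
        = fls_abs t (fls_X_inv * poly_to_fls p)"
      by (rule fls_abs_add_eq)
    then show ?thesis
      using False pCons.IH[OF False] X by (simp add: add.commute)
  qed
qed simp

text \<open>Discreteness of the polynomials: it makes polynomial parts unique and bounds the
  exponent from above.\<close>

lemma fls_abs_poly_to_fls_ge_1:
  assumes "p \<noteq> 0"
  shows "fls_abs t (poly_to_fls p) \<ge> 1"
  using t assms by (simp add: fls_abs_poly_to_fls)

lemma fls_abs_poly_to_fls_less_1_iff [simp]: "fls_abs t (poly_to_fls p) < 1 \<longleftrightarrow> p = 0"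
  using fls_abs_poly_to_fls_ge_1[of p] by fastforce

lemma fls_abs_poly_to_fls_le_iff:
  assumes "p \<noteq> 0" "q \<noteq> 0"
  shows "fls_abs t (poly_to_fls p) \<le> fls_abs t (poly_to_fls q) \<longleftrightarrow> degree p \<le> degree q"
  using t assms by (simp add: fls_abs_poly_to_fls)

lemma one_less_fls_abs_poly_to_fls_iff: "fls_abs t (poly_to_fls p) > 1 \<longleftrightarrow> degree p > 0"
  using t by (cases "p = 0"; cases "degree p = 0") (auto simp: fls_abs_poly_to_fls)

lemma le_fls_abs_poly_to_fls:
  assumes "degree p > 0"
  shows "fls_abs t (poly_to_fls p) \<ge> t"
proof -
  have "p \<noteq> 0"
    using assms by auto
  then show ?thesis
    using t assms power_increasing[of 1 "degree p" t] by (simp add: fls_abs_poly_to_fls)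
qed

lemma poly_to_fls_eq_0_iff [simp]: "poly_to_fls p = 0 \<longleftrightarrow> p = 0"
  using fls_abs_poly_to_fls_ge_1[of p] by fastforce

section \<open>Continued fractions\<close>

text \<open>The tail convergent has the size of \<open>b 1\<close>, which exceeds 1, so its
  reciprocal is below 1. Thus \<open>b 0\<close> is the polynomial part of every convergent.\<close>

lemma fls_abs_cfrac_convergent_diff_less:
  assumes "\<And>i. i \<ge> 1 \<Longrightarrow> degree (b i) > 0"
  shows "fls_abs t (cfrac_convergent b n - poly_to_fls (b 0)) < 1"
  using assms
proof (induction n arbitrary: b)
  case (Suc n)
  have "degree (b 1) > 0"
    using Suc.prems by simp
  then have b1: "fls_abs t (poly_to_fls (b 1)) > 1"
    by (simp add: one_less_fls_abs_poly_to_fls_iff)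
  have "fls_abs t (cfrac_convergent (\<lambda>i. b (Suc i)) n - poly_to_fls (b 1)) < 1"
    using Suc.IH[of "\<lambda>i. b (Suc i)"] Suc.prems by simp
  then have "fls_abs t (cfrac_convergent (\<lambda>i. b (Suc i)) n) = fls_abs t (poly_to_fls (b 1))"
    using fls_abs_add_eq[of "cfrac_convergent (\<lambda>i. b (Suc i)) n - poly_to_fls (b 1)"
      "poly_to_fls (b 1)"] b1 by simp
  moreover have "1 / fls_abs t (poly_to_fls (b 1)) < 1"
    using b1 by (subst divide_less_eq_1_pos) linarith+
  ultimately show ?case
    by simp
qed simp

lemma fls_abs_cfrac_convergent:
  assumes "\<And>i. degree (b i) > 0"
  shows "fls_abs t (cfrac_convergent b n) = fls_abs t (poly_to_fls (b 0))"
proof -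
  have "fls_abs t (cfrac_convergent b n - poly_to_fls (b 0)) < 1"
    using assms by (rule fls_abs_cfrac_convergent_diff_less)
  also have "1 < fls_abs t (poly_to_fls (b 0))"
    using assms by (simp add: one_less_fls_abs_poly_to_fls_iff)
  finally show ?thesis
    using fls_abs_add_eq[of "cfrac_convergent b n - poly_to_fls (b 0)" "poly_to_fls (b 0)"] by simp
qed

text \<open>\<open>B\<close> plays the role of the complete quotients. Passing to reciprocals
  divides an error by a product of two sizes, one at least \<open>t\<close> and the other above 1,
  so each level gains a factor \<open>1 / t\<close>.\<close>

lemma fls_abs_cfrac_convergent_diff_le:
  assumes "\<And>i. i \<ge> 1 \<Longrightarrow> degree (b i) > 0"
    and "\<And>n. B n = poly_to_fls (b n) + 1 / B (Suc n)"
    and "\<And>n. n \<ge> 1 \<Longrightarrow> fls_abs t (B n) > 1"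
  shows "fls_abs t (cfrac_convergent b n - B 0) \<le> (1 / t) ^ n"
  using assms
proof (induction n arbitrary: b B)
  case 0
  have "fls_abs t (B 1) > 1"
    using "0.prems"(3) by simp
  then have "1 / fls_abs t (B 1) \<le> 1"
    by (subst divide_le_eq_1_pos) linarith+
  then show ?case
    using "0.prems"(2)[of 0] by simp
next
  case (Suc n)
  let ?u = "cfrac_convergent (\<lambda>i. b (Suc i)) n"
  have IH: "fls_abs t (?u - B 1) \<le> (1 / t) ^ n"
    using Suc.IH[of "\<lambda>i. b (Suc i)" "\<lambda>i. B (Suc i)", OF _ Suc.prems(2)] Suc.prems(1,3) by simp
  have B1: "fls_abs t (B 1) > 1"
    using Suc.prems(3) by simp
  have "fls_abs t ?u = fls_abs t (poly_to_fls (b 1))"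
    using fls_abs_cfrac_convergent[of "\<lambda>i. b (Suc i)"] Suc.prems(1) by simp
  then have u: "fls_abs t ?u \<ge> t"
    using le_fls_abs_poly_to_fls[of "b 1"] Suc.prems(1) by simp
  have nz: "?u \<noteq> 0" "B 1 \<noteq> 0"
    using u B1 t by fastforce+
  have "cfrac_convergent b (Suc n) - B 0 = 1 / ?u - 1 / B 1"
    using Suc.prems(2)[of 0] by simp
  also have "\<dots> = - ((?u - B 1) / (?u * B 1))"
    using nz by (simp add: field_simps)
  finally have "fls_abs t (cfrac_convergent b (Suc n) - B 0)
      = fls_abs t (?u - B 1) / (fls_abs t ?u * fls_abs t (B 1))"
    by simp
  also have "\<dots> \<le> (1 / t) ^ n / (t * 1)"
    using IH u B1 t by (intro frac_le mult_mono) auto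
  finally show ?case
    by simp
qed

end

text \<open>Establishes an expansion from a guess for all complete quotients, without numerators and
  denominators of convergents.\<close>

lemma cfrac_expansionI:
  fixes b :: "nat \<Rightarrow> 'a::field poly"
  assumes deg: "\<And>i. i \<ge> 1 \<Longrightarrow> degree (b i) > 0"
    and "\<And>n. B n = poly_to_fls (b n) + 1 / B (Suc n)"
    and "\<And>n. n \<ge> 1 \<Longrightarrow> fls_abs 2 (B n) > 1"
  shows "cfrac_expansion (B 0) b"
proof -
  have bound: "fls_abs 2 (cfrac_convergent b n - B 0) \<le> (1 / 2) ^ n" for n
    by (rule fls_abs_cfrac_convergent_diff_le) (simp, erule deg, rule assms(2), erule assms(3))
  have "(\<lambda>n. (1 / 2) ^ n :: real) \<longlonglongrightarrow> 0"
    by (intro LIMSEQ_realpow_zero) auto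
  from tendsto_sandwich[OF _ _ tendsto_const this]
  have "(\<lambda>n. dist (cfrac_convergent b n) (B 0)) \<longlonglongrightarrow> 0"
    by (simp_all add: dist_fls_eq_fls_abs bound)
  then show ?thesis
    unfolding cfrac_expansion_def using deg tendsto_dist_iff by blast
qed

section \<open>Uniqueness of the continued fraction expansion\<close>

lemma irrational_fls_complete_quotient:
  fixes x :: "'a::field fls"
  assumes "irrational_fls x"
  shows "x \<noteq> poly_to_fls p" "irrational_fls (1 / (x - poly_to_fls p))"
proof -
  show ne: "x \<noteq> poly_to_fls p"
    using assms unfolding irrational_fls_def
    by (metis div_by_1 one_neq_zero poly_to_fls_1)
  show "irrational_fls (1 / (x - poly_to_fls p))"
    unfolding irrational_fls_def
  proof (intro allI impI notI)
    fix P Q :: "'a poly"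
    assume "Q \<noteq> 0" and eq: "1 / (x - poly_to_fls p) = poly_to_fls P / poly_to_fls Q"
    then have "P \<noteq> 0"
      using ne by auto
    then have P: "poly_to_fls P \<noteq> 0"
      by (simp add: poly_to_fls_eq_0_iff[of 2])
    have "x - poly_to_fls p = 1 / (1 / (x - poly_to_fls p))"
      by simp
    also have "\<dots> = poly_to_fls Q / poly_to_fls P"
      unfolding eq by simp
    finally have "x = poly_to_fls p + poly_to_fls Q / poly_to_fls P"
      by (simp only: diff_eq_eq add.commute)
    then have "x = poly_to_fls (p * P + Q) / poly_to_fls P"
      using P by (simp add: add_divide_distrib)
    then show False
      using assms \<open>P \<noteq> 0\<close> unfolding irrational_fls_def by blast
  qed
qed

text \<open>One step of the algorithm: every convergent lies at distance below 1 from
  \<open>b 0\<close>, hence so does the limit, and continuity of inversion carries convergence over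
  to the tail.\<close>

lemma cfrac_expansion_unfold:
  fixes x :: "'a::field fls"
  assumes exp: "cfrac_expansion x b" and irr: "irrational_fls x"
  shows "fls_abs 2 (x - poly_to_fls (b 0)) < 1"
    and "cfrac_expansion (1 / (x - poly_to_fls (b 0))) (\<lambda>i. b (Suc i))"
proof -
  have deg: "degree (b i) > 0" if "i \<ge> 1" for i
    using exp that by (simp add: cfrac_expansion_def)
  have lim: "(\<lambda>n. cfrac_convergent b n) \<longlonglongrightarrow> x"
    using exp by (simp add: cfrac_expansion_def)
  obtain n where "fls_abs 2 (cfrac_convergent b n - x) < 1"
    using tendstoD[OF lim, of 1] unfolding eventually_sequentially dist_fls_eq_fls_abs by auto
  moreover have "fls_abs 2 (cfrac_convergent b n - poly_to_fls (b 0)) < 1"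
    using deg by (intro fls_abs_cfrac_convergent_diff_less) auto
  ultimately show "fls_abs 2 (x - poly_to_fls (b 0)) < 1"
    using fls_abs_diff_less[of 2 "cfrac_convergent b n - poly_to_fls (b 0)" 1
        "cfrac_convergent b n - x"] by simp
  define v where "v = x - poly_to_fls (b 0)"
  define w where "w n = cfrac_convergent (\<lambda>i. b (Suc i)) n" for n
  have v: "v \<noteq> 0"
    using irrational_fls_complete_quotient(1)[OF irr] by (simp add: v_def)
  then have v_pos: "fls_abs 2 v > 0"
    by simp
  have w: "w n \<noteq> 0" for n
  proof -
    have "fls_abs 2 (w n) \<ge> 2"
      unfolding w_def
      using fls_abs_cfrac_convergent[of 2 "\<lambda>i. b (Suc i)" n] le_fls_abs_poly_to_fls[of 2 "b 1"] deg
      by simp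
    then show ?thesis by auto
  qed
  have "w \<longlonglongrightarrow> 1 / v"
  proof (rule tendstoI)
    fix e :: real assume "e > 0"
    \<comment> \<open>The first bound forces \<open>|1 / w n| = |v|\<close>, so inverting multiplies
      the error by exactly \<open>1 / |v|^2\<close>; the second bound absorbs this factor.\<close>
    then have "min (fls_abs 2 v) (e * fls_abs 2 v ^ 2) > 0"
      using v_pos by simp
    with LIMSEQ_Suc[OF lim] have "\<forall>\<^sub>F n in sequentially.
        dist (cfrac_convergent b (Suc n)) x < min (fls_abs 2 v) (e * fls_abs 2 v ^ 2)"
      by (rule tendstoD)
    then show "\<forall>\<^sub>F n in sequentially. dist (w n) (1 / v) < e"
    proof eventually_elim
      case (elim n)
      have "cfrac_convergent b (Suc n) - x = 1 / w n - v"
        by (simp add: v_def w_def)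
      with elim have less: "fls_abs 2 (1 / w n - v) < fls_abs 2 v"
          "fls_abs 2 (1 / w n - v) < e * fls_abs 2 v ^ 2"
        by (simp_all add: dist_fls_eq_fls_abs)
      have abs_w: "1 / fls_abs 2 (w n) = fls_abs 2 v"
        using fls_abs_add_eq[OF _ less(1)] by simp
      have "w n - 1 / v = - (w n / v * (1 / w n - v))"
        using v w[of n] by (simp add: field_simps)
      then have "fls_abs 2 (w n - 1 / v)
          = fls_abs 2 (w n) / fls_abs 2 v * fls_abs 2 (1 / w n - v)"
        by simp
      also have "fls_abs 2 (w n) = 1 / fls_abs 2 v"
        unfolding abs_w[symmetric] by simp
      also have "1 / fls_abs 2 v / fls_abs 2 v * fls_abs 2 (1 / w n - v) < e"
        using less(2) v_pos by (simp add: field_simps power2_eq_square)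
      finally show ?case
        by (simp add: dist_fls_eq_fls_abs)
    qed
  qed
  then show "cfrac_expansion (1 / (x - poly_to_fls (b 0))) (\<lambda>i. b (Suc i))"
    using deg by (simp add: cfrac_expansion_def v_def w_def[abs_def])
qed

lemma cfrac_expansion_unique_0:
  fixes x :: "'a::field fls"
  assumes "cfrac_expansion x b" "cfrac_expansion x b'" "irrational_fls x"
  shows "b 0 = b' 0"
proof -
  have "fls_abs 2 ((x - poly_to_fls (b' 0)) - (x - poly_to_fls (b 0))) < 1"
    using assms by (intro fls_abs_diff_less cfrac_expansion_unfold(1)) auto
  then have "fls_abs 2 (poly_to_fls (b 0 - b' 0)) < 1"
    by simp
  then show ?thesis
    using fls_abs_poly_to_fls_less_1_iff[of 2 "b 0 - b' 0"] by simp
qed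

text \<open>Induction over all \<open>x\<close> at once: equal heads leave the same complete
  quotient, again irrational, with the two shifted sequences as expansions.\<close>

lemma cfrac_expansion_unique:
  fixes x :: "'a::field fls"
  assumes "cfrac_expansion x b" "cfrac_expansion x b'" "irrational_fls x"
  shows "b n = b' n"
  using assms
proof (induction n arbitrary: x b b')
  case 0
  then show ?case
    by (rule cfrac_expansion_unique_0)
next
  case (Suc n x b b')
  have "b 0 = b' 0"
    using Suc.prems by (rule cfrac_expansion_unique_0)
  then show ?case
    using Suc.IH[OF cfrac_expansion_unfold(2)[OF Suc.prems(1,3)], of "\<lambda>i. b' (Suc i)"]
      cfrac_expansion_unfold(2)[OF Suc.prems(2,3)] irrational_fls_complete_quotient(2)[OF Suc.prems(3)]
    by simp
qed

section \<open>Characteristic three\<close>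

text \<open>The sum of all elements is invariant under translation by 1, which adds
  \<open>CARD('a)\<close> ones to it. For infinite types \<open>CARD('a)\<close> is 0 by
  convention.\<close>

lemma of_nat_CARD_eq_0: "of_nat CARD('a) = (0 :: 'a::ring_1)"
proof (cases "finite (UNIV :: 'a set)")
  case True
  have "(\<Sum>x\<in>UNIV. x + 1 :: 'a) = (\<Sum>x\<in>UNIV. x)"
    by (rule sum.reindex_bij_witness[of _ "\<lambda>x. x - 1" "\<lambda>x. x + 1"]) auto
  then show ?thesis
    by (simp add: sum.distrib)
qed simp

context
  assumes three: "(3 :: 'a::comm_ring_1) = 0"
begin

text \<open>Additivity of Frobenius, over commutative rings so that it serves both polynomials and
  Laurent series.\<close>

lemma cube_add: "(x + y) ^ 3 = x ^ 3 + y ^ 3" for x y :: 'a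
proof -
  have "(x + y) ^ 3 = x ^ 3 + y ^ 3 + 3 * (x\<^sup>2 * y + x * y\<^sup>2)"
    by (simp add: power3_eq_cube power2_eq_square algebra_simps)
  then show ?thesis
    by (simp add: three)
qed

lemma cube_diff: "(x - y) ^ 3 = x ^ 3 - y ^ 3" for x y :: 'a
  using cube_add[of "x - y" y] by (simp add: algebra_simps)

text \<open>The fraction \<open>p' / q'\<close> is the image of \<open>p / q\<close> under two steps of the map
  \<open>x \<mapsto> 1 / (A - C * x ^ 3)\<close>, where \<open>A = C * K\<close>, after cancelling a common factor \<open>C\<close>.\<close>

lemma quartic_form_substitution:
  fixes C K p q :: 'a
  defines "p' \<equiv> C\<^sup>2 * (K * q ^ 3 - p ^ 3) ^ 3"
    and "q' \<equiv> C * K * (C\<^sup>2 * (K * q ^ 3 - p ^ 3) ^ 3) - q ^ 9"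
  shows "C * p' ^ 4 - C * K * p' * q' ^ 3 + q' ^ 4 = (C * p ^ 4 - C * K * p * q ^ 3 + q ^ 4) ^ 9"
proof -
  have p': "p' = C\<^sup>2 * (K ^ 3 * q ^ 9 - p ^ 9)"
    by (simp add: p'_def cube_diff power_mult_distrib flip: power_mult)
  have p'3: "p' ^ 3 = C ^ 6 * (K ^ 9 * q ^ 27 - p ^ 27)"
    by (simp add: p' cube_diff power_mult_distrib flip: power_mult)
  have q': "q' = C * K * p' - q ^ 9"
    by (simp add: q'_def p'_def)
  have q'3: "q' ^ 3 = C ^ 3 * K ^ 3 * p' ^ 3 - q ^ 27"
    by (simp add: q' cube_diff power_mult_distrib flip: power_mult)
  \<comment> \<open>The terms with \<open>q' ^ 3\<close> are grouped because the cofactor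
    \<open>q' - C * K * p'\<close> is just \<open>- q ^ 9\<close>.\<close>
  have "C * p' ^ 4 - C * K * p' * q' ^ 3 + q' ^ 4 = C * p' ^ 4 + q' ^ 3 * (q' - C * K * p')"
    by (simp add: algebra_simps power3_eq_cube power4_eq_xxxx)
  also have "\<dots> = C * p' ^ 4 - (C ^ 3 * K ^ 3 * p' ^ 3 - q ^ 27) * q ^ 9"
    unfolding q'3 by (simp add: q')
  also have "\<dots> = p' ^ 3 * (C * p' - C ^ 3 * K ^ 3 * q ^ 9) + q ^ 36"
    by (simp add: algebra_simps power3_eq_cube power4_eq_xxxx flip: power_add)
  \<comment> \<open>Here \<open>C * p'\<close> is \<open>C ^ 3 * (K ^ 3 * q ^ 9 - p ^ 9)\<close>, so
    the terms with \<open>K\<close> cancel.\<close>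
  also have "C * p' - C ^ 3 * K ^ 3 * q ^ 9 = - (C ^ 3 * p ^ 9)"
    by (simp add: p' algebra_simps power3_eq_cube power2_eq_square)
  also have "p' ^ 3 * - (C ^ 3 * p ^ 9) + q ^ 36
      = C ^ 9 * p ^ 36 - C ^ 9 * K ^ 9 * p ^ 9 * q ^ 27 + q ^ 36"
  proof -
    have "p' ^ 3 * - (C ^ 3 * p ^ 9)
        = C ^ 6 * C ^ 3 * (p ^ 27 * p ^ 9) - C ^ 6 * C ^ 3 * K ^ 9 * p ^ 9 * q ^ 27"
      unfolding p'3 by (simp add: algebra_simps)
    then show ?thesis
      by (simp flip: power_add)
  qed
  also have "\<dots> = ((C * p ^ 4 - C * K * p * q ^ 3 + q ^ 4) ^ 3) ^ 3"
    by (simp add: cube_add cube_diff power_mult_distrib flip: power_mult)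
  finally show ?thesis
    by (simp flip: power_mult)
qed

end

section \<open>The quartic equation\<close>

text \<open>The parity of \<open>n\<close> is that of the index \<open>n + 2\<close> being defined.
  Under the hypotheses on \<open>A\<close> and \<open>C\<close> the \<open>div\<close> is exact, by
  \<open>dvd_partial_quotient_power\<close>.\<close>

fun partial_quotient :: "'a::field poly \<Rightarrow> 'a poly \<Rightarrow> nat \<Rightarrow> 'a poly" where
  "partial_quotient A C 0 = 0"
| "partial_quotient A C (Suc 0) = A"
| "partial_quotient A C (Suc (Suc n)) =
     (if odd n then - C * partial_quotient A C (Suc n) ^ 3
      else partial_quotient A C (Suc n) ^ 3 div (- C))"

text \<open>Defined by the recursion of the partial quotients; that these are complete quotients is
  the content of \<open>complete_quotient_step\<close>.\<close>

fun complete_quotient :: "'a::field fls \<Rightarrow> 'a fls \<Rightarrow> nat \<Rightarrow> 'a fls" where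
  "complete_quotient \<beta> c 0 = \<beta>"
| "complete_quotient \<beta> c (Suc 0) = 1 / \<beta>"
| "complete_quotient \<beta> c (Suc (Suc n)) =
     (if odd n then - c * complete_quotient \<beta> c (Suc n) ^ 3
      else complete_quotient \<beta> c (Suc n) ^ 3 / (- c))"

text \<open>\<open>t\<close> stays a parameter because the locale is used twice: at the given value
  and at 2, the base of the library metric.\<close>

locale quartic_fls =
  fixes A C :: "'a::field poly" and \<beta> :: "'a fls" and t :: real
  assumes three: "(3 :: 'a) = 0"
    and t: "t > 1"
    and A: "A \<noteq> 0" and C: "C \<noteq> 0"
    and degree_le: "degree C \<le> degree A"
    and dvd: "C dvd A"
    and equation: "poly_to_fls C * \<beta> ^ 4 - poly_to_fls A * \<beta> + 1 = 0"
    and abs_\<beta>: "fls_abs t \<beta> < 1"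
begin

abbreviation "a \<equiv> poly_to_fls A"
abbreviation "c \<equiv> poly_to_fls C"

lemmas [simp] = fls_abs_pos_iff[OF t] fls_abs_nonneg[OF t] fls_abs_eq_0_iff[OF t] fls_abs_mult[OF t]
  fls_abs_divide[OF t] fls_abs_uminus[OF t] fls_abs_power[OF t] poly_to_fls_eq_0_iff[OF t]

lemma three_fls: "(3 :: 'a fls) = 0"
  using three fls_const_numeral[of "num.Bit1 num.One", where ?'a = 'a] by simp

lemma three_poly: "(3 :: 'a poly) = 0"
  using three by (simp add: numeral_poly)

lemma nonzero: "\<beta> \<noteq> 0" "a \<noteq> 0" "c \<noteq> 0"
  using equation A C by auto

lemma abs_c: "1 \<le> fls_abs t c" "fls_abs t c \<le> fls_abs t a"
  using fls_abs_poly_to_fls_ge_1[OF t C] fls_abs_poly_to_fls_le_iff[OF t C A] degree_le by auto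

text \<open>By the degree condition \<open>|c * z| < |c| \<le> |a|\<close>, so \<open>a\<close>
  dominates.\<close>

lemma abs_diff_c_mult:
  assumes "fls_abs t z < 1"
  shows "fls_abs t (a - c * z) = fls_abs t a"
proof (rule fls_abs_diff_eq[OF t])
  have "fls_abs t (c * z) < fls_abs t c"
    using assms nonzero by simp
  then show "fls_abs t (c * z) < fls_abs t a"
    using abs_c by linarith
qed

lemma inverse_\<beta>: "1 / \<beta> = a - c * \<beta> ^ 3"
proof -
  have "(a - c * \<beta> ^ 3) * \<beta> = 1"
    using equation by (simp add: algebra_simps power3_eq_cube power4_eq_xxxx)
  then show ?thesis
    using nonzero by (simp add: field_simps)
qed

lemma abs_power_\<beta>: "fls_abs t (\<beta> ^ 3) < 1"
  using abs_\<beta> by (simp add: power_less_one_iff)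

lemma abs_inverse_\<beta>: "fls_abs t (1 / \<beta>) = fls_abs t a"
  unfolding inverse_\<beta> by (rule abs_diff_c_mult[OF abs_power_\<beta>])

text \<open>Positive degree of \<open>A\<close> is not assumed; it is forced by
  \<open>|a| = |1 / \<beta>|\<close> and \<open>|\<beta>| < 1\<close>.\<close>

lemma abs_a: "1 < fls_abs t a"
proof -
  have "fls_abs t \<beta> > 0"
    using nonzero by simp
  then have "1 < 1 / fls_abs t \<beta>"
    using abs_\<beta> by (subst less_divide_eq_1_pos) auto
  then show ?thesis
    using abs_inverse_\<beta> fls_abs_1[of t, where ?'a = 'a] t by simp
qed

text \<open>Makes the \<open>div\<close> at even indices exact: a partial quotient of odd index is
  \<open>A\<close> itself or carries the factor \<open>C\<close> from the preceding step.\<close>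

lemma dvd_partial_quotient_power:
  assumes "even n"
  shows "C dvd partial_quotient A C (Suc n) ^ 3"
proof (cases n)
  case 0
  then show ?thesis
    using dvd_trans[OF dvd, of "A ^ 3"] by (simp add: power3_eq_cube)
next
  case (Suc m)
  with assms have "partial_quotient A C (Suc n) = C * - (partial_quotient A C (Suc m) ^ 3)"
    by simp
  then have "C dvd partial_quotient A C (Suc n)"
    by (metis dvd_triv_left)
  then show ?thesis
    by (rule dvd_trans) (rule dvd_power, simp)
qed

lemma poly_to_fls_partial_quotient:
  "poly_to_fls (partial_quotient A C (Suc (Suc n))) =
    (if odd n then - c * poly_to_fls (partial_quotient A C (Suc n)) ^ 3
     else poly_to_fls (partial_quotient A C (Suc n)) ^ 3 / (- c))"
proof (cases "odd n")
  case False
  then have "partial_quotient A C (Suc n) ^ 3 = (- C) * partial_quotient A C (Suc (Suc n))"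
    using dvd_partial_quotient_power[of n] by simp
  then have "poly_to_fls (partial_quotient A C (Suc n) ^ 3)
      = poly_to_fls ((- C) * partial_quotient A C (Suc (Suc n)))"
    by (rule arg_cong)
  then show ?thesis
    using False nonzero by (simp del: partial_quotient.simps)
qed simp

text \<open>Cubing \<open>x = e + 1 / y\<close> gives \<open>x ^ 3 = e ^ 3 + 1 / y ^ 3\<close>.
  Multiplying by \<open>- c\<close> divides the last denominator by \<open>- c\<close>, and
  conversely, which is why the two rules alternate.\<close>

lemma complete_quotient_step:
  "complete_quotient \<beta> c n =
     poly_to_fls (partial_quotient A C n) + 1 / complete_quotient \<beta> c (Suc n)"
proof (induction n rule: induct_nat_012)
  case 1
  \<comment> \<open>The left side is the reciprocal of the complete quotient of index 2, so this
    case is the quartic equation itself.\<close>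
  have "1 / ((1 / \<beta>) ^ 3 / (- c)) = - (c * \<beta> ^ 3)"
    by (simp add: power_one_over)
  then show ?case
    using inverse_\<beta> by simp
next
  case (ge2 n)
  define x where "x = complete_quotient \<beta> c (Suc n)"
  define y where "y = complete_quotient \<beta> c (Suc (Suc n))"
  define e where "e = poly_to_fls (partial_quotient A C (Suc n))"
  have "x = e + 1 / y"
    using ge2(2) by (simp only: x_def y_def e_def)
  then have x: "x ^ 3 = e ^ 3 + 1 / y ^ 3"
    using cube_add[OF three_fls, of e "1 / y"] by (simp add: power_one_over)
  have rec: "complete_quotient \<beta> c (Suc (Suc n)) = (if odd n then - c * x ^ 3 else x ^ 3 / (- c))"
      "complete_quotient \<beta> c (Suc (Suc (Suc n))) = (if odd n then y ^ 3 / (- c) else - c * y ^ 3)"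
      "poly_to_fls (partial_quotient A C (Suc (Suc n)))
        = (if odd n then - c * e ^ 3 else e ^ 3 / (- c))"
    by (simp_all add: x_def y_def e_def poly_to_fls_partial_quotient del: partial_quotient.simps)
  show ?case
    unfolding rec x by (cases "odd n") (simp_all add: distrib_left add_divide_distrib)
qed simp

text \<open>Only division by \<open>c\<close> could lose size, and there
  \<open>|x| ^ 3 \<ge> |a| * |c|\<close> still leaves at least \<open>|a|\<close>.\<close>

lemma abs_complete_quotient: "fls_abs t a \<le> fls_abs t (complete_quotient \<beta> c (Suc n))"
proof (induction n)
  case 0
  then show ?case
    using abs_inverse_\<beta> by simp
next
  case (Suc n)
  let ?x = "fls_abs t (complete_quotient \<beta> c (Suc n))"
  have x: "1 \<le> ?x"
    using Suc abs_a by linarith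
  have "fls_abs t a * fls_abs t c \<le> ?x * ?x"
    using Suc abs_c by (intro mult_mono) auto
  also have "\<dots> \<le> ?x ^ 3"
    using x power_increasing[of 2 3 ?x] by (simp add: power2_eq_square)
  finally have ac: "fls_abs t a * fls_abs t c \<le> ?x ^ 3" .
  show ?case
  proof (cases "odd n")
    case True
    have "fls_abs t a \<le> fls_abs t a * fls_abs t c"
      using mult_left_mono[OF abs_c(1), of "fls_abs t a"] by simp
    also have "\<dots> \<le> 1 * ?x ^ 3"
      using ac by simp
    also have "\<dots> \<le> fls_abs t c * ?x ^ 3"
      using abs_c by (intro mult_right_mono) auto
    finally show ?thesis
      using True by simp
  next
    case False
    have "fls_abs t a \<le> ?x ^ 3 / fls_abs t c"
      using ac abs_c nonzero by (subst le_divide_eq) auto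
    then show ?thesis
      using False by simp
  qed
qed

text \<open>The partial quotient is \<open>x - 1 / y\<close> with \<open>|1 / y| < 1 < |x|\<close>,
  so it has the size of \<open>x\<close>.\<close>

lemma degree_partial_quotient:
  assumes "n \<ge> 1"
  shows "degree (partial_quotient A C n) > 0"
proof -
  obtain m where n: "n = Suc m"
    using assms by (cases n) auto
  let ?x = "complete_quotient \<beta> c n" and ?y = "complete_quotient \<beta> c (Suc n)"
  have xy: "1 < fls_abs t ?x" "1 < fls_abs t ?y"
    using abs_complete_quotient[of m] abs_complete_quotient[of n] abs_a unfolding n by linarith+
  then have "1 / fls_abs t ?y < fls_abs t ?x"
    using divide_less_eq_1_pos[of "fls_abs t ?y" 1] by linarith
  then have "fls_abs t (1 / ?y) < fls_abs t ?x"
    using fls_abs_1[of t, where ?'a = 'a] t by simp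
  then have "fls_abs t (?x - 1 / ?y) = fls_abs t ?x"
    by (rule fls_abs_diff_eq[OF t])
  moreover have "?x - 1 / ?y = poly_to_fls (partial_quotient A C n)"
    using complete_quotient_step[of n] by (simp only: add_diff_cancel_right')
  ultimately show ?thesis
    using xy one_less_fls_abs_poly_to_fls_iff[OF t] by metis
qed

section \<open>The approximation exponent\<close>

lemma quartic_form_abs:
  assumes "q \<noteq> 0" and less: "fls_abs t (poly_to_fls p / poly_to_fls q - \<beta>) < 1"
  shows "fls_abs t (poly_to_fls (C * p ^ 4 - A * p * q ^ 3 + q ^ 4))
    = fls_abs t a * fls_abs t (poly_to_fls q) ^ 4 * fls_abs t (poly_to_fls p / poly_to_fls q - \<beta>)"
proof -
  define y where "y = poly_to_fls p / poly_to_fls q - \<beta>"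
  \<comment> \<open>Chosen so that \<open>(\<beta> + y) ^ 4 = \<beta> ^ 4 + y * z\<close>; the
    equation for \<open>\<beta>\<close> then leaves a multiple of \<open>y\<close> whose cofactor
    \<open>a - c * z\<close> has the size of \<open>a\<close>.\<close>
  define z where "z = \<beta> ^ 3 + (\<beta> * y\<^sup>2 + y ^ 3)"
  have y: "fls_abs t y < 1"
    using less by (simp add: y_def)
  have p: "poly_to_fls p = (\<beta> + y) * poly_to_fls q"
    using \<open>q \<noteq> 0\<close> by (simp add: y_def)
  have "(\<beta> + y) ^ 4 = (\<beta> ^ 3 + y ^ 3) * (\<beta> + y)"
    using cube_add[OF three_fls, of \<beta> y] by (simp add: power3_eq_cube power4_eq_xxxx mult_ac)
  then have "c * (\<beta> + y) ^ 4 - a * (\<beta> + y) + 1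
      = (c * \<beta> ^ 4 - a * \<beta> + 1) - y * (a - c * z)"
    by (simp add: z_def algebra_simps power2_eq_square power3_eq_cube power4_eq_xxxx)
  then have "c * (\<beta> + y) ^ 4 - a * (\<beta> + y) + 1 = - (y * (a - c * z))"
    using equation by simp
  moreover have "poly_to_fls (C * p ^ 4 - A * p * q ^ 3 + q ^ 4)
      = poly_to_fls q ^ 4 * (c * (\<beta> + y) ^ 4 - a * (\<beta> + y) + 1)"
    by (simp add: p power_mult_distrib algebra_simps power3_eq_cube power4_eq_xxxx)
  moreover have "fls_abs t (a - c * z) = fls_abs t a"
  proof (rule abs_diff_c_mult)
    have "fls_abs t (\<beta> * y\<^sup>2) < 1 * 1"
      unfolding fls_abs_mult[OF t] using abs_\<beta> y
      by (intro mult_strict_mono') (auto simp: power_less_one_iff)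
    moreover have "fls_abs t (y ^ 3) < 1"
      using y by (simp add: power_less_one_iff)
    ultimately show "fls_abs t z < 1"
      unfolding z_def using abs_power_\<beta> by (intro fls_abs_add_less[OF t]) simp_all
  qed
  ultimately show ?thesis
    unfolding y_def[symmetric] fls_abs_mult[OF t] fls_abs_power[OF t] fls_abs_uminus[OF t]
    by (simp only: fls_abs_mult[OF t] fls_abs_power[OF t] fls_abs_uminus[OF t] mult_ac)
qed

text \<open>A Liouville-type bound: near \<open>\<beta>\<close>, irrationality makes the polynomial
  value of the quartic form nonzero, hence of size at least 1; otherwise every factor is at least
  1.\<close>

lemma abs_diff_rational_ge:
  assumes "irrational_fls \<beta>" and "q \<noteq> 0"
  shows "1 \<le> fls_abs t a * fls_abs t (poly_to_fls q) ^ 4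
    * fls_abs t (\<beta> - poly_to_fls p / poly_to_fls q)"
proof (cases "fls_abs t (\<beta> - poly_to_fls p / poly_to_fls q) < 1")
  case True
  let ?F = "C * p ^ 4 - A * p * q ^ 3 + q ^ 4"
  have eq: "fls_abs t (poly_to_fls ?F) = fls_abs t a * fls_abs t (poly_to_fls q) ^ 4
      * fls_abs t (\<beta> - poly_to_fls p / poly_to_fls q)"
    using quartic_form_abs[OF \<open>q \<noteq> 0\<close>, of p] True
    by (simp only: fls_abs_minus_commute[OF t, of \<beta>])
  have "\<beta> - poly_to_fls p / poly_to_fls q \<noteq> 0"
    using assms unfolding irrational_fls_def by simp
  then have "fls_abs t (poly_to_fls ?F) \<noteq> 0"
    unfolding eq using assms(2) nonzero by simp
  then have "?F \<noteq> 0"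
    by (metis fls_abs_0 poly_to_fls_0)
  then show ?thesis
    using fls_abs_poly_to_fls_ge_1[OF t] eq by metis
next
  case False
  have "1 * 1 * 1 \<le> fls_abs t a * fls_abs t (poly_to_fls q) ^ 4
    * fls_abs t (\<beta> - poly_to_fls p / poly_to_fls q)"
    using False abs_a fls_abs_poly_to_fls_ge_1[OF t \<open>q \<noteq> 0\<close>]
    by (intro mult_mono) auto
  then show ?thesis by simp
qed

text \<open>From \<open>p = 0\<close>, \<open>q = 1\<close> on,
  \<open>quartic_form_substitution\<close> turns a representation of 1 into one of
  \<open>1 ^ 9\<close> with larger \<open>q\<close>. The condition \<open>|p| < |q|\<close> prevents
  cancellation and later places \<open>p / q\<close> near \<open>\<beta>\<close>.\<close>

lemma quartic_form_eq_1:
  "\<exists>p q. C * p ^ 4 - A * p * q ^ 3 + q ^ 4 = 1 \<and> q \<noteq> 0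
     \<and> fls_abs t (poly_to_fls p) < fls_abs t (poly_to_fls q) \<and> n \<le> degree q"
proof (induction n)
  case 0
  show ?case
    using t by (intro exI[of _ 0] exI[of _ 1]) simp
next
  case (Suc n)
  then obtain p q where F: "C * p ^ 4 - A * p * q ^ 3 + q ^ 4 = 1" and q: "q \<noteq> 0"
    and less: "fls_abs t (poly_to_fls p) < fls_abs t (poly_to_fls q)" and n: "n \<le> degree q"
    by blast
  obtain K where K: "A = C * K"
    using dvd by (rule dvdE)
  then have "K \<noteq> 0"
    using A by auto
  let ?abs = "\<lambda>p. fls_abs t (poly_to_fls p)"
  define s where "s = K * q ^ 3 - p ^ 3"
  define p' where "p' = C\<^sup>2 * s ^ 3"
  define q' where "q' = A * p' - q ^ 9"
  have q1: "1 \<le> ?abs q"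
    using q by (rule fls_abs_poly_to_fls_ge_1[OF t])
  have q3: "?abs (q ^ 3) \<le> ?abs (K * q ^ 3)"
    using fls_abs_poly_to_fls_ge_1[OF t \<open>K \<noteq> 0\<close>] mult_right_mono[of 1 "?abs K" "?abs q ^ 3"] by simp
  have "?abs (p ^ 3) < ?abs (q ^ 3)"
    using less by (simp add: power_strict_mono)
  with q3 have "?abs s = ?abs (K * q ^ 3)"
    unfolding s_def poly_to_fls_diff by (intro fls_abs_diff_eq[OF t]) linarith
  with q3 have "?abs q ^ 3 \<le> ?abs s"
    by simp
  then have "(?abs q ^ 3) ^ 3 \<le> ?abs s ^ 3"
    by (rule power_mono) simp
  moreover have "1 * ?abs s ^ 3 \<le> ?abs C ^ 2 * ?abs s ^ 3"
    using abs_c by (intro mult_right_mono) simp_all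
  ultimately have p': "?abs q ^ 9 \<le> ?abs p'"
    by (simp add: p'_def flip: power_mult)
  then have p'_pos: "1 \<le> ?abs p'"
    using q1 one_le_power[of "?abs q" 9] by linarith
  then have Ap': "?abs p' < ?abs A * ?abs p'"
    using abs_a by (subst mult_less_cancel_right1) linarith
  \<comment> \<open>As \<open>|A| > 1\<close>, the term \<open>A * p'\<close> dominates
    \<open>q ^ 9\<close> in \<open>q'\<close>.\<close>
  with p' have "?abs (q ^ 9) < ?abs (A * p')"
    by simp
  then have q': "?abs q' = ?abs A * ?abs p'"
    unfolding q'_def poly_to_fls_diff by (simp add: fls_abs_diff_eq[OF t])
  have "q' \<noteq> 0"
    using q' p'_pos Ap' by fastforce
  moreover have "?abs p' < ?abs q'"
    using q' Ap' by simp
  moreover have "Suc n \<le> degree q'"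
  proof -
    have "?abs q \<le> ?abs q ^ 9"
      using q1 power_increasing[of 1 9 "?abs q"] by simp
    then have "?abs q < ?abs q'"
      using p' q' Ap' by linarith
    then have "degree q < degree q'"
      using fls_abs_poly_to_fls_le_iff[OF t \<open>q' \<noteq> 0\<close> q] by linarith
    with n show ?thesis by simp
  qed
  moreover have "C * p' ^ 4 - A * p' * q' ^ 3 + q' ^ 4 = 1"
    using quartic_form_substitution[OF three_poly, of C K q p] F
    by (simp add: K p'_def q'_def s_def)
  ultimately show ?case
    by blast
qed

lemma irrationality_measure_eq_4:
  assumes irr: "irrational_fls \<beta>"
  shows "irrationality_measure t \<beta> = 4"
proof -
  let ?abs = "\<lambda>p. fls_abs t (poly_to_fls p)"
  define y where "y P Q = fls_abs t (\<beta> - poly_to_fls P / poly_to_fls Q)" for P Q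
  define F where "F = filtercomap (\<lambda>(P :: 'a poly, Q :: 'a poly). ?abs Q) at_top"
  define f where "f = (\<lambda>(P, Q). ereal (- (ln (y P Q) / ln (?abs Q))))"
  have y_pos: "y P Q > 0" if "Q \<noteq> 0" for P Q
    using irr that unfolding y_def irrational_fls_def by simp
  have measure: "irrationality_measure t \<beta> = Limsup F f"
    by (simp add: irrationality_measure_def F_def f_def y_def)
  have "Limsup F f \<le> 4"
    unfolding Limsup_le_iff
  proof (intro allI impI)
    fix u :: ereal assume "4 < u"
    then obtain r where r: "4 < ereal r" "ereal r < u"
      using ereal_dense2 by blast
    then have "r > 4"
      by simp
    \<comment> \<open>The threshold ensures \<open>ln |a| < (r - 4) * ln |Q|\<close>, which absorbs
      the constant \<open>ln |a|\<close> into the excess of \<open>r\<close> over 4.\<close>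
    have "f (P, Q) < u" if large: "?abs Q > exp (ln (fls_abs t a) / (r - 4))" for P Q
    proof -
      have "Q \<noteq> 0"
        using large by (metis exp_gt_zero fls_abs_0 less_asym poly_to_fls_0)
      have Q_pos: "?abs Q > 0"
        using \<open>Q \<noteq> 0\<close> by simp
      have ln_a: "ln (fls_abs t a) > 0"
        by (rule ln_gt_zero[OF abs_a])
      have large': "ln (?abs Q) > ln (fls_abs t a) / (r - 4)"
        using large Q_pos by (metis exp_gt_zero ln_exp ln_less_cancel_iff)
      then have L: "ln (?abs Q) > 0"
        using ln_a \<open>r > 4\<close> divide_pos_pos[of "ln (fls_abs t a)" "r - 4"] by linarith
      have "0 \<le> ln (fls_abs t a * ?abs Q ^ 4 * y P Q)"
        using abs_diff_rational_ge[OF irr \<open>Q \<noteq> 0\<close>, of P] by (simp add: y_def del: fls_abs_mult)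
      also have "\<dots> = ln (fls_abs t a) + 4 * ln (?abs Q) + ln (y P Q)"
        using y_pos[OF \<open>Q \<noteq> 0\<close>, of P] Q_pos nonzero
        by (simp add: ln_mult ln_realpow)
      finally have "- ln (y P Q) \<le> ln (fls_abs t a) + 4 * ln (?abs Q)"
        by linarith
      also have "\<dots> < r * ln (?abs Q)"
        using large' \<open>r > 4\<close> by (simp add: field_simps)
      finally have "- ln (y P Q) / ln (?abs Q) < r"
        by (subst pos_divide_less_eq[OF L])
      then show ?thesis
        using r(2) by (simp add: f_def) (meson ereal_less_le less_ereal.simps(1) less_trans)
    qed
    then show "\<forall>\<^sub>F x in F. f x < u"
      unfolding F_def eventually_filtercomap
      using eventually_gt_at_top[of "exp (ln (fls_abs t a) / (r - 4))"] by fastforce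
  qed
  \<comment> \<open>Solutions of value 1 give \<open>- ln y = ln |a| + 4 * ln |q|\<close> exactly,
    so the quotient is at least 4 for \<open>q\<close> of arbitrarily large degree.\<close>
  moreover have "\<not> Limsup F f < 4"
  proof
    assume "Limsup F f < 4"
    then have "\<forall>\<^sub>F x in F. f x < 4"
      by (rule Limsup_lessD)
    then obtain N where N: "\<And>P Q. ?abs Q \<ge> N \<Longrightarrow> f (P, Q) < 4"
      unfolding F_def eventually_filtercomap eventually_at_top_linorder by force
    obtain n where n: "N < t ^ n"
      using real_arch_pow[OF t] by blast
    \<comment> \<open>\<open>Suc n\<close> keeps the degree positive even for \<open>n = 0\<close>,
      so that \<open>ln |q| > 0\<close>.\<close>
    obtain p q where F: "C * p ^ 4 - A * p * q ^ 3 + q ^ 4 = 1" and q: "q \<noteq> 0"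
      and less: "?abs p < ?abs q" and deg: "Suc n \<le> degree q"
      using quartic_form_eq_1 by blast
    have q_pos: "?abs q > 0"
      using q by simp
    have q1: "?abs q > 1"
      using deg by (subst one_less_fls_abs_poly_to_fls_iff[OF t]) simp
    have "t ^ n \<le> ?abs q"
      using t deg q by (simp add: fls_abs_poly_to_fls[OF t] power_increasing)
    then have "f (p, q) < 4"
      using n by (intro N) linarith
    moreover have "4 \<le> - ln (y p q) / ln (?abs q)"
    proof -
      have "fls_abs t (poly_to_fls p / poly_to_fls q) < 1"
        using less q_pos by (simp add: divide_less_eq_1_pos)
      then have "fls_abs t (poly_to_fls p / poly_to_fls q - \<beta>) < 1"
        using abs_\<beta> by (rule fls_abs_diff_less[OF t])
      from quartic_form_abs[OF q this] have "fls_abs t a * ?abs q ^ 4 * y p q = 1"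
        unfolding F y_def fls_abs_minus_commute[OF t, of \<beta>]
        using fls_abs_1[OF t, where ?'a = 'a] by simp
      then have "0 = ln (fls_abs t a * ?abs q ^ 4 * y p q)"
        by simp
      also have "\<dots> = ln (fls_abs t a) + 4 * ln (?abs q) + ln (y p q)"
        using y_pos[OF q, of p] q_pos nonzero by (simp add: ln_mult ln_realpow)
      finally have "4 * ln (?abs q) \<le> - ln (y p q)"
        using ln_gt_zero[OF abs_a] by linarith
      then show ?thesis
        by (subst pos_le_divide_eq[OF ln_gt_zero[OF q1]])
    qed
    ultimately show False
      by (simp add: f_def)
  qed
  ultimately show ?thesis
    unfolding measure by auto
qed

end

theorem theorem2:
  fixes A C :: "'a::field poly" and \<beta> :: "'a fls" and t :: real
  assumes "CARD('a) = 3"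
    and "t > 1"
    and "A \<noteq> 0" and "C \<noteq> 0"
    and "degree A \<ge> degree C"
    and "C dvd A"
    and "irrational_fls \<beta>"
    and "poly_to_fls C * \<beta> ^ 4 - poly_to_fls A * \<beta> + 1 = 0"
    and "fls_abs t \<beta> < 1"
  shows "(\<exists>b. cfrac_expansion \<beta> b) \<and>
    (\<forall>b. cfrac_expansion \<beta> b \<longrightarrow>
      b 0 = 0 \<and> b 1 = A \<and>
      (\<forall>n\<ge>2. if odd n then b n = - C * b (n - 1) ^ 3
              else (- C) dvd b (n - 1) ^ 3 \<and> b n = b (n - 1) ^ 3 div (- C))) \<and>
    irrationality_measure t \<beta> = 4"
proof -
  have "(3 :: 'a) = 0"
    using of_nat_CARD_eq_0[where ?'a = 'a] assms(1) by simp
  then interpret quartic_fls A C \<beta> t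
    by unfold_locales (use assms in auto)
  \<comment> \<open>The condition \<open>|\<beta>| < 1\<close> is the same for every base above 1;
    base 2 is needed for convergence.\<close>
  have "fls_abs 2 \<beta> < 1"
    using assms(2,9) by (simp add: fls_abs_less_1_iff)
  then interpret two: quartic_fls A C \<beta> 2
    by unfold_locales (use three A C degree_le dvd equation in auto)
  let ?b = "partial_quotient A C"
  have expansion: "cfrac_expansion \<beta> ?b"
  proof -
    have "fls_abs 2 (complete_quotient \<beta> c n) > 1" if "n \<ge> 1" for n
      using two.abs_complete_quotient[of "n - 1"] two.abs_a that by simp
    then have "cfrac_expansion (complete_quotient \<beta> c 0) ?b"
      using complete_quotient_step degree_partial_quotient by (intro cfrac_expansionI)
    then show ?thesis by simp
  qed
  \<comment> \<open>Uniqueness reduces the claim about all expansions to the one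
    constructed.\<close>
  have unique: "b = ?b" if "cfrac_expansion \<beta> b" for b
    using cfrac_expansion_unique[OF that expansion assms(7)] by (rule ext)
  have recursion: "if odd n then ?b n = - C * ?b (n - 1) ^ 3
      else (- C) dvd ?b (n - 1) ^ 3 \<and> ?b n = ?b (n - 1) ^ 3 div (- C)" if n_ge: "n \<ge> 2" for n
  proof -
    obtain m where n: "n = Suc (Suc m)"
      using le_Suc_ex[OF n_ge] by auto
    show ?thesis
      using dvd_partial_quotient_power[of m] unfolding n by (cases "odd m") simp_all
  qed
  show ?thesis
  proof (intro conjI allI impI)
    show "\<exists>b. cfrac_expansion \<beta> b"
      using expansion by blast
    show "irrationality_measure t \<beta> = 4"
      by (rule irrationality_measure_eq_4[OF assms(7)])
  next
    fix b assume "cfrac_expansion \<beta> b"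
    then have b: "b = ?b"
      by (rule unique)
    show "b 0 = 0" "b 1 = A"
      unfolding b by simp_all
    show "if odd n then b n = - C * b (n - 1) ^ 3
        else (- C) dvd b (n - 1) ^ 3 \<and> b n = b (n - 1) ^ 3 div (- C)" if "n \<ge> 2" for n
      unfolding b using that by (rule recursion)
  qed
qed

end
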